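(* Let $n\ge 2$ and let $A$ be an $n\times n$ real matrix that is real accretive, i.e. the symmetric matrix $\frac{A+A^{\top}}{2}$ is positive semidefinite. Then $$\sqrt{\det A_{n-1}(1,1)\,\det A_{n-1}(2,2)}\ \ge\ \left|\frac{\det A_{n-1}(1,2)+\det A_{n-1}(2,1)}{2}\right|,$$ where it is part of the assertion that the product under the square root is nonnegative.
   Context: For an $n\times n$ matrix $A=(a_{pq})$, integers $1\le r\le n$ and $1\le i,j\le n-r+1$, $A_r(i,j):=(a_{pq})_{i\le p\le i+r-1,\ j\le q\le j+r-1}$ denotes the $r\times r$ contiguous submatrix of $A$ consisting of rows $i,\dots,i+r-1$ and columns $j,\dots,j+r-1$. *)

theory Defs
  imports Complex_Main "Jordan_Normal_Form.Determinant"
begin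

(* A_r(i,j): rows i, ..., i+r-1 and columns j, ..., j+r-1.  Here i, j are 1-based as in the
   source, while matrix entries in the library are 0-based; meaningful for
   i, j >= 1 and i+r-1, j+r-1 at most the dimensions of A. *)
definition contiguous_submatrix :: "'a mat \<Rightarrow> nat \<Rightarrow> nat \<Rightarrow> nat \<Rightarrow> 'a mat" where
  "contiguous_submatrix A r i j = mat r r (\<lambda>(p, q). A $$ (i - 1 + p, j - 1 + q))"

definition positive_semidefinite :: "real mat \<Rightarrow> bool" where
  "positive_semidefinite S \<longleftrightarrow>
     square_mat S \<and> transpose_mat S = S \<and>
     (\<forall>x \<in> carrier_vec (dim_row S). x \<bullet> (S *\<^sub>v x) \<ge> 0)"

definition real_accretive :: "real mat \<Rightarrow> bool" where
  "real_accretive A \<longleftrightarrow>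
     square_mat A \<and> positive_semidefinite ((1 / 2) \<cdot>\<^sub>m (A + transpose_mat A))"

end

theory Submission
  imports Defs
begin

text \<open>Up to the common sign \<open>(-1)\<^sup>n\<^sup>-\<^sup>1\<close> of the off-diagonal ones, the four minors are the corner
  entries of the adjugate of \<open>A\<close>. If the quadratic form of \<open>A\<close> is positive definite, then
  \<open>det A > 0\<close>, and the substitution \<open>x = A y\<close> shows that the form of the adjugate is nonnegative
  as well; its restriction to the span of the first and last unit vectors gives the inequality.
  The general case follows by applying this to \<open>A + t I\<close> and letting \<open>t\<close> tend to \<open>0\<close>.\<close>

text \<open>By the Leibniz formula, \<open>det\<close> is a polynomial in the entries. Needed twice:
  for continuity along a segment of matrices and for the final limit.\<close>

lemma tendsto_det:
  fixes F :: "'b \<Rightarrow> real mat"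
  assumes "\<And>t. F t \<in> carrier_mat n n" and "L \<in> carrier_mat n n"
    and "\<And>i j. i < n \<Longrightarrow> j < n \<Longrightarrow> ((\<lambda>t. F t $$ (i, j)) \<longlongrightarrow> L $$ (i, j)) net"
  shows "((\<lambda>t. det (F t)) \<longlongrightarrow> det L) net"
  unfolding det_def'[OF assms(1)] det_def'[OF assms(2)]
  by (intro tendsto_sum tendsto_mult tendsto_const tendsto_prod assms(3))
    (auto simp: permutes_in_image)

lemma smult_mult_mat_vec:
  fixes A :: "'a :: comm_semiring_0 mat"
  assumes "A \<in> carrier_mat nr nc" "v \<in> carrier_vec nc"
  shows "(c \<cdot>\<^sub>m A) *\<^sub>v v = c \<cdot>\<^sub>v (A *\<^sub>v v)"
  using assms by (intro eq_vecI) (auto simp: scalar_prod_def sum_distrib_left ac_simps intro!: sum.cong)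

lemma scalar_prod_self_pos:
  fixes x :: "real vec"
  assumes "x \<in> carrier_vec n" "x \<noteq> 0\<^sub>v n"
  shows "x \<bullet> x > 0"
  using conjugate_square_greater_0_vec[OF assms(1)] assms(2) by simp

text \<open>On the segment from the identity to \<open>M\<close> every matrix has a positive
  definite form and so is nonsingular. The determinant starts at 1 and by the intermediate value
  theorem cannot become nonpositive without vanishing. This avoids eigenvalues, as \<open>M\<close>
  may be nonsymmetric.\<close>

lemma det_pos_of_quadratic_form_pos:
  fixes M :: "real mat"
  assumes M: "M \<in> carrier_mat n n"
    and pos: "\<And>x. x \<in> carrier_vec n \<Longrightarrow> x \<noteq> 0\<^sub>v n \<Longrightarrow> x \<bullet> (M *\<^sub>v x) > 0"
  shows "det M > 0"
proof (rule ccontr)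
  assume neg: "\<not> det M > 0"
  define F where "F s = (1 - s) \<cdot>\<^sub>m 1\<^sub>m n + s \<cdot>\<^sub>m M" for s :: real
  have F: "F s \<in> carrier_mat n n" for s
    using M by (simp add: F_def)
  have "isCont (\<lambda>s. det (F s)) s" for s
    unfolding isCont_def
    by (rule tendsto_det[OF F F]) (use M in \<open>auto simp: F_def intro!: tendsto_eq_intros\<close>)
  moreover have "F 0 = 1\<^sub>m n" "F 1 = M"
    using M by (auto simp: F_def)
  ultimately obtain s where s: "0 \<le> s" "s \<le> 1" "det (F s) = 0"
    using IVT2[of "\<lambda>s. det (F s)" 1 0 0] neg by auto
  obtain x where x: "x \<in> carrier_vec n" "x \<noteq> 0\<^sub>v n" "F s *\<^sub>v x = 0\<^sub>v n"
    using s(3) det_0_iff_vec_prod_zero[OF F] by blast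
  have "F s *\<^sub>v x = (1 - s) \<cdot>\<^sub>v x + s \<cdot>\<^sub>v (M *\<^sub>v x)"
    unfolding F_def using x(1) M
    by (simp add: add_mult_distrib_mat_vec[of _ n n] smult_mult_mat_vec[of _ n n])
  then have "x \<bullet> (F s *\<^sub>v x) = (1 - s) * (x \<bullet> x) + s * (x \<bullet> (M *\<^sub>v x))"
    using x(1) M by (simp add: scalar_prod_add_distrib[of _ n])
  moreover have "x \<bullet> (F s *\<^sub>v x) = 0"
    using x by simp
  moreover have "(1 - s) * (x \<bullet> x) + s * (x \<bullet> (M *\<^sub>v x)) > 0"
  \<comment> \<open>For \<open>s > 0\<close> strictness comes from the form of \<open>M\<close>; at
    \<open>s = 0\<close> that term vanishes and \<open>x \<bullet> x\<close> has to supply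
    it.\<close>
  proof (cases "s = 0")
    case True
    then show ?thesis using scalar_prod_self_pos[OF x(1,2)] by simp
  next
    case False
    then show ?thesis
      using s pos[OF x(1,2)] scalar_prod_self_pos[OF x(1,2)]
      by (intro add_nonneg_pos mult_nonneg_nonneg mult_pos_pos) auto
  qed
  ultimately show False by simp
qed

text \<open>With \<open>y = adj_mat M *\<^sub>v x\<close> one has
  \<open>M *\<^sub>v y = det M \<cdot>\<^sub>v x\<close>, so the value sought, times
  \<open>det M > 0\<close>, is the form of \<open>M\<close> at \<open>y\<close>.\<close>

lemma adj_mat_quadratic_form_nonneg:
  fixes M :: "real mat"
  assumes M: "M \<in> carrier_mat n n"
    and pos: "\<And>x. x \<in> carrier_vec n \<Longrightarrow> x \<noteq> 0\<^sub>v n \<Longrightarrow> x \<bullet> (M *\<^sub>v x) > 0"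
    and x: "x \<in> carrier_vec n"
  shows "x \<bullet> (adj_mat M *\<^sub>v x) \<ge> 0"
proof -
  note adj = adj_mat[OF M]
  define y where "y = adj_mat M *\<^sub>v x"
  have y: "y \<in> carrier_vec n"
    using adj(1) x by (simp add: y_def)
  have "M *\<^sub>v y = (M * adj_mat M) *\<^sub>v x"
    unfolding y_def using M adj(1) x by simp
  also have "\<dots> = det M \<cdot>\<^sub>v x"
    unfolding adj(2) using x by (simp add: smult_mult_mat_vec[of _ n n])
  finally have "y \<bullet> (M *\<^sub>v y) = det M * (x \<bullet> y)"
    using x y comm_scalar_prod[OF x y] by simp
  moreover have "y \<bullet> (M *\<^sub>v y) \<ge> 0"
  proof (cases "y = 0\<^sub>v n")
    case True
    then show ?thesis using M y by simp
  next
    case False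
    then show ?thesis using pos[OF y] by simp
  qed
  moreover have "det M > 0"
    using det_pos_of_quadratic_form_pos[OF M pos] .
  ultimately show ?thesis
    unfolding y_def by (simp add: zero_le_mult_iff)
qed

lemma quadratic_form_two_unit_vecs:
  fixes B :: "real mat" and a b :: real
  assumes B: "B \<in> carrier_mat n n" and i: "i < n" and j: "j < n"
  defines "x \<equiv> a \<cdot>\<^sub>v unit_vec n i + b \<cdot>\<^sub>v unit_vec n j"
  shows "x \<bullet> (B *\<^sub>v x) = a\<^sup>2 * B $$ (i, i) + a * b * (B $$ (i, j) + B $$ (j, i)) + b\<^sup>2 * B $$ (j, j)"
proof -
  have x: "x \<in> carrier_vec n" by (simp add: x_def)
  have row: "(B *\<^sub>v x) $ k = a * B $$ (k, i) + b * B $$ (k, j)" if "k < n" for k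
    using B i j that by (simp add: x_def scalar_prod_add_distrib[of _ n])
  have "x \<bullet> (B *\<^sub>v x) = a * (B *\<^sub>v x) $ i + b * (B *\<^sub>v x) $ j"
    using B i j x by (subst x_def) (simp add: add_scalar_prod_distrib[of _ n])
  then show ?thesis
    by (simp add: row i j power2_eq_square algebra_simps)
qed

lemma binary_quadratic_form_discriminant:
  fixes p q s :: real
  assumes form: "\<And>a b. a\<^sup>2 * p + a * b * (2 * q) + b\<^sup>2 * s \<ge> 0"
  shows "q\<^sup>2 \<le> p * s"
proof -
  have p: "p \<ge> 0" and s: "s \<ge> 0"
    using form[of 1 0] form[of 0 1] by simp_all
  show ?thesis
  proof (cases "p = 0")
    case True
    have "2 * q\<^sup>2 + s * q\<^sup>2 \<le> 0"
      \<comment> \<open>With \<open>p = 0\<close> the form is linear in \<open>a\<close>; this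
        \<open>a\<close> makes the cross term outweigh \<open>s * q\<^sup>2\<close>, forcing
        \<open>q = 0\<close>.\<close>
      using form[of "- (s + 1)" q] True by (simp add: power2_eq_square algebra_simps)
    moreover have "s * q\<^sup>2 \<ge> 0"
      using s by simp
    ultimately have "q\<^sup>2 \<le> 0"
      by linarith
    then show ?thesis using True by simp
  next
    case False
    have "p * (p * s - q\<^sup>2) \<ge> 0"
      \<comment> \<open>For \<open>p > 0\<close> and fixed \<open>b\<close>, the form is least at
        \<open>a = - q * b / p\<close>; scaling clears the denominator.\<close>
      using form[of "- q" p] by (simp add: power2_eq_square algebra_simps)
    then show ?thesis using p False by (simp add: zero_le_mult_iff)
  qed
qed

text \<open>A block of size \<open>n - 1\<close> starting at 1 omits the last row or column, one
  starting at 2 the first; \<open>mat_delete\<close> counts from 0.\<close>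

lemma contiguous_submatrix_corners:
  assumes "A \<in> carrier_mat n n" "n \<ge> 2"
  shows "contiguous_submatrix A (n - 1) 1 1 = mat_delete A (n - 1) (n - 1)"
    and "contiguous_submatrix A (n - 1) 2 2 = mat_delete A 0 0"
    and "contiguous_submatrix A (n - 1) 1 2 = mat_delete A (n - 1) 0"
    and "contiguous_submatrix A (n - 1) 2 1 = mat_delete A 0 (n - 1)"
  using assms by (auto simp: contiguous_submatrix_def mat_delete_def)

lemma corner_minors_of_quadratic_form_pos:
  fixes M :: "real mat"
  assumes M: "M \<in> carrier_mat n n" and n: "n \<ge> 2"
    and pos: "\<And>x. x \<in> carrier_vec n \<Longrightarrow> x \<noteq> 0\<^sub>v n \<Longrightarrow> x \<bullet> (M *\<^sub>v x) > 0"
  defines "D i j \<equiv> det (contiguous_submatrix M (n - 1) i j)"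
  shows "((D 1 2 + D 2 1) / 2)\<^sup>2 \<le> D 1 1 * D 2 2"
proof -
  let ?B = "adj_mat M"
  let ?e = "(- 1) ^ (n - 1) :: real"
  note B = adj_mat(1)[OF M]
  have bounds: "0 < n" "n - 1 < n" using n by auto
  \<comment> \<open>The adjugate is the transposed cofactor matrix: entry \<open>(0, n - 1)\<close>
    deletes row \<open>n - 1\<close> and column \<open>0\<close>, which leaves the block at
    \<open>(1, 2)\<close>.\<close>
  have entries: "?B $$ (0, 0) = D 2 2" "?B $$ (n - 1, n - 1) = D 1 1"
    "?B $$ (0, n - 1) = ?e * D 1 2" "?B $$ (n - 1, 0) = ?e * D 2 1"
    using M n bounds unfolding D_def contiguous_submatrix_corners[OF M n]
    by (auto simp: adj_mat_def cofactor_def)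
  have "(?e * ((D 1 2 + D 2 1) / 2))\<^sup>2 \<le> D 2 2 * D 1 1"
  proof (rule binary_quadratic_form_discriminant)
    fix a b :: real
    let ?x = "a \<cdot>\<^sub>v unit_vec n 0 + b \<cdot>\<^sub>v unit_vec n (n - 1)"
    have "?x \<bullet> (?B *\<^sub>v ?x) \<ge> 0"
      using adj_mat_quadratic_form_nonneg[OF M pos] by simp
    then show "a\<^sup>2 * D 2 2 + a * b * (2 * (?e * ((D 1 2 + D 2 1) / 2))) + b\<^sup>2 * D 1 1 \<ge> 0"
      unfolding quadratic_form_two_unit_vecs[OF B bounds] entries
      by (simp add: field_simps)
  qed
  \<comment> \<open>The common sign of the off-diagonal corners disappears on squaring.\<close>
  moreover have "?e\<^sup>2 = 1"
    by (simp add: power2_eq_square flip: power_mult_distrib)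
  ultimately show ?thesis
    unfolding power_mult_distrib by (simp add: mult.commute)
qed

text \<open>The skew part of \<open>A\<close> contributes nothing to the form, so \<open>A\<close>
  and its symmetric part have the same one.\<close>

lemma real_accretive_quadratic_form:
  assumes A: "A \<in> carrier_mat n n" and acc: "real_accretive A" and x: "x \<in> carrier_vec n"
  shows "x \<bullet> (A *\<^sub>v x) \<ge> 0"
proof -
  have At: "transpose_mat A \<in> carrier_mat n n" using A by simp
  have Atx: "transpose_mat A *\<^sub>v x \<in> carrier_vec n"
    using At x by (rule mult_mat_vec_carrier)
  have "x \<bullet> (transpose_mat A *\<^sub>v x) = x \<bullet> (A *\<^sub>v x)"
    using transpose_vec_mult_scalar[OF A x x] comm_scalar_prod[OF x Atx] by simp
  moreover have "((1 / 2) \<cdot>\<^sub>m (A + transpose_mat A)) *\<^sub>v x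
      = (1 / 2) \<cdot>\<^sub>v (A *\<^sub>v x + transpose_mat A *\<^sub>v x)"
    using A At x by (simp add: smult_mult_mat_vec[of _ n n] add_mult_distrib_mat_vec[of _ n n])
  ultimately have "x \<bullet> (((1 / 2) \<cdot>\<^sub>m (A + transpose_mat A)) *\<^sub>v x) = x \<bullet> (A *\<^sub>v x)"
    using A x Atx by (simp add: scalar_prod_add_distrib[of _ n])
  then show ?thesis
    using acc A x unfolding real_accretive_def positive_semidefinite_def by auto
qed

theorem theorem1p5:
  fixes A :: "real mat" and n :: nat
  assumes "n \<ge> 2"
    and "A \<in> carrier_mat n n"
    and "real_accretive A"
  shows "det (contiguous_submatrix A (n - 1) 1 1) * det (contiguous_submatrix A (n - 1) 2 2) \<ge> 0
    \<and> sqrt (det (contiguous_submatrix A (n - 1) 1 1) * det (contiguous_submatrix A (n - 1) 2 2))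
        \<ge> \<bar>(det (contiguous_submatrix A (n - 1) 1 2) + det (contiguous_submatrix A (n - 1) 2 1)) / 2\<bar>"
proof -
  note n = assms(1) and A = assms(2)
  define D where "D M i j = det (contiguous_submatrix M (n - 1) i j)" for M :: "real mat" and i j
  define F where "F t = A + t \<cdot>\<^sub>m 1\<^sub>m n" for t :: real
  have F: "F t \<in> carrier_mat n n" for t
    using A by (simp add: F_def)
  have pos: "x \<bullet> (F t *\<^sub>v x) > 0" if "t > 0" "x \<in> carrier_vec n" "x \<noteq> 0\<^sub>v n" for t x
  proof -
    have "F t *\<^sub>v x = A *\<^sub>v x + t \<cdot>\<^sub>v x"
      unfolding F_def using A that(2)
      by (simp add: add_mult_distrib_mat_vec[of _ n n] smult_mult_mat_vec[of _ n n])
    then have "x \<bullet> (F t *\<^sub>v x) = x \<bullet> (A *\<^sub>v x) + t * (x \<bullet> x)"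
      using A that(2) by (simp add: scalar_prod_add_distrib[of _ n])
    then show ?thesis
      using real_accretive_quadratic_form[OF A assms(3) that(2)]
        scalar_prod_self_pos[OF that(2,3)] that(1) by (simp add: add_nonneg_pos)
  qed
  \<comment> \<open>Starting indices 1 and 2 keep the block inside the matrix, where the entries of
    \<open>F t\<close> are known.\<close>
  have lim: "((\<lambda>t. D (F t) i j) \<longlongrightarrow> D A i j) (at_right 0)"
    if "i \<in> {1, 2}" "j \<in> {1, 2}" for i j
    unfolding D_def
  proof (rule tendsto_det[where n = "n - 1"])
    fix p q assume "p < n - 1" "q < n - 1"
    then show "((\<lambda>t. contiguous_submatrix (F t) (n - 1) i j $$ (p, q))
        \<longlongrightarrow> contiguous_submatrix A (n - 1) i j $$ (p, q)) (at_right 0)"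
      using that A by (auto simp: contiguous_submatrix_def F_def intro!: tendsto_eq_intros)
  qed (simp_all add: contiguous_submatrix_def)
  \<comment> \<open>The squared inequality is the one taken to the limit; it yields both the
    nonnegative product and, after a square root, the claimed bound.\<close>
  have ineq: "((D A 1 2 + D A 2 1) / 2)\<^sup>2 \<le> D A 1 1 * D A 2 2"
  proof (rule tendsto_le)
    show "((\<lambda>t. D (F t) 1 1 * D (F t) 2 2) \<longlongrightarrow> D A 1 1 * D A 2 2) (at_right 0)"
      by (intro tendsto_mult lim) auto
    show "((\<lambda>t. ((D (F t) 1 2 + D (F t) 2 1) / 2)\<^sup>2) \<longlongrightarrow> ((D A 1 2 + D A 2 1) / 2)\<^sup>2) (at_right 0)"
      by (intro tendsto_power tendsto_divide tendsto_add tendsto_const lim) auto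
    show "\<forall>\<^sub>F t in at_right 0. ((D (F t) 1 2 + D (F t) 2 1) / 2)\<^sup>2 \<le> D (F t) 1 1 * D (F t) 2 2"
      using corner_minors_of_quadratic_form_pos[OF F n pos]
      by (auto simp: D_def eventually_at_right_less intro: eventually_mono[OF eventually_at_right_less])
  qed simp
  have "D A 1 1 * D A 2 2 \<ge> 0"
    using ineq zero_le_power2 order_trans by blast
  moreover have "\<bar>(D A 1 2 + D A 2 1) / 2\<bar> \<le> sqrt (D A 1 1 * D A 2 2)"
    using real_sqrt_le_mono[OF ineq] by simp
  ultimately show ?thesis
    unfolding D_def by blast
qed

end
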